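(* For each $m\ge1$, let $X_{m,i}=s_m+N_{m,i}$, $i=1,\dots,n_m$, where $s_m$ is a $p_m$-dimensional (deterministic) signal vector and $N_{m,i}$, $i=1,\dots,n_m$, are mutually independent random vectors in $\mathbb R^{p_m}$ such that $N_{m,i}=_d-N_{m,i}$. Let $X_m$ be the $n_m\times p_m$ matrix with rows $X_{m,i}^\top$, and let $\Theta_{m1}\subset\mathbb R^{p_m}$. Consider the sequence of randomization tests of the null hypotheses $s_m=0$ with statistics $f_m(X_m)=n_m^{-1}\|1_{n_m}^\top X_m\|_\infty$ and randomization distribution uniform over the $n_m\times n_m$ diagonal matrices with independent Rademacher diagonal entries, acting by left multiplication on $X_m$. As $m\to\infty$, this sequence of tests is consistent against the sequence of alternatives with $s_m\in\Theta_{m1}$ if there is a sequence $(t_m)_{m\ge1}$ such that, with probability tending to unity, $\|n_m^{-1}\sum_{i=1}^{n_m}N_{m,i}\|_\infty\le t_m$, and for any sequence $(s_m)_{m\ge1}$ with $s_m\in\Theta_{m1}$ for all $m\ge 1$, $$\liminf_{m\to\infty}\frac{\|s_m\|_\infty}{2t_m}>1.$$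
   Context: Randomization test: given a statistic $f_m$, a fixed $\alpha\in(0,1]$, an integer $K\ge1$, and a group acting linearly on the data, draw $G_{m1},\dots,G_{mK}$ iid from the uniform distribution on the group, independently of the data; let $f_{(1)}\le\dots\le f_{(K+1)}$ be the ordered values of $f_m(X_m),f_m(G_{m1}X_m),\dots,f_m(G_{mK}X_m)$ and $k=\lceil(1-\alpha)(K+1)\rceil$; reject when $f_m(X_m)>f_{(k)}$ (with $f_{(0)}=-\infty$, relevant only if $\alpha=1$). Here the group is the group of $n_m\times n_m$ diagonal matrices with $\pm1$ diagonal entries. Consistent against $s_m\in\Theta_{m1}$ means: for every sequence $(s_m)_{m\ge1}$ with $s_m\in\Theta_{m1}$ for all $m$, the rejection probability (over the noise and the random group elements) tends to $1$ as $m\to\infty$. $1_n$ is the all-ones vector in $\mathbb R^n$; a Rademacher variable is uniform on $\{\pm1\}$; $=_d$ is equality in distribution.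
   Formalization: Two conditions are added: α(K+1) ≥ 1, since otherwise k = K+1 and the test never rejects; and, when α < 1, n_m → ∞, since otherwise all the random sign matrices equal ±I with probability not tending to 0 and the statistics tie. *)

theory Defs
  imports "HOL-Probability.Probability" "Jordan_Normal_Form.Matrix"
begin

unbundle no vec_syntax

(* The Borel sigma-algebra on R^p.  Vectors of the AFP type vec carry no topology, so it is
   transported from the product of p copies of the real line along the coordinate map. *)
definition borel_vec :: "nat \<Rightarrow> real vec measure" where
  "borel_vec p = vimage_algebra (carrier_vec p) (\<lambda>v. \<lambda>j\<in>{..<p}. v $ j) (PiM {..<p} (\<lambda>_. borel))"

(* Meaningful for dim_vec v > 0 only (Max of the empty set is unspecified). *)
definition sup_norm :: "real vec \<Rightarrow> real" where
  "sup_norm v = Max ((\<lambda>j. \<bar>v $ j\<bar>) ` {..<dim_vec v})"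

definition sign_group :: "nat \<Rightarrow> real mat set" where
  "sign_group n = {D \<in> carrier_mat n n. diagonal_mat D \<and> (\<forall>i<n. D $$ (i,i) \<in> {1, -1})}"

(* pmf_of_set is the uniform distribution only on finite nonempty sets. *)
lemma sign_group_nonempty: "sign_group n \<noteq> {}"
proof -
  have "1\<^sub>m n \<in> sign_group n"
    by (auto simp: sign_group_def diagonal_mat_def)
  then show ?thesis by blast
qed

lemma finite_sign_group: "finite (sign_group n)"
proof -
  let ?F = "{..<n} \<rightarrow>\<^sub>E {1, -1 :: real}"
  have "sign_group n \<subseteq> (\<lambda>f. mat n n (\<lambda>(i,j). if i = j then f i else 0)) ` ?F"
  proof
    fix D assume D: "D \<in> sign_group n"
    let ?f = "\<lambda>i\<in>{..<n}. D $$ (i,i)"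
    have "D = mat n n (\<lambda>(i,j). if i = j then ?f i else 0)"
      using D by (intro eq_matI) (auto simp: sign_group_def diagonal_mat_def)
    moreover have "?f \<in> ?F" using D by (auto simp: sign_group_def)
    ultimately show "D \<in> (\<lambda>f. mat n n (\<lambda>(i,j). if i = j then f i else 0)) ` ?F" by blast
  qed
  moreover have "finite ?F" by (intro finite_PiE) auto
  ultimately show ?thesis by (meson finite_imageI finite_subset)
qed

definition data_matrix :: "nat \<Rightarrow> nat \<Rightarrow> real vec \<Rightarrow> (nat \<Rightarrow> real vec) \<Rightarrow> real mat" where
  "data_matrix n p s N = mat_of_rows p (map (\<lambda>i. s + N i) [0..<n])"

definition mean_vec :: "nat \<Rightarrow> nat \<Rightarrow> (nat \<Rightarrow> real vec) \<Rightarrow> real vec" where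
  "mean_vec n p N = vec p (\<lambda>j. (\<Sum>i<n. N i $ j) / real n)"

(* The row vector 1^T X is represented by the column vector X^T 1. *)
definition mean_stat :: "real mat \<Rightarrow> real" where
  "mean_stat X = sup_norm (X\<^sup>T *\<^sub>v vec (dim_row X) (\<lambda>_. 1)) / real (dim_row X)"

(* k-th smallest entry, counted from 1, with the convention that the 0-th one is -infinity. *)
definition order_stat :: "real list \<Rightarrow> nat \<Rightarrow> ereal" where
  "order_stat xs k = (if k = 0 then -\<infinity> else ereal (sort xs ! (k - 1)))"

(* gs is the list of drawn group elements, so K = length gs. *)
definition rejects :: "(real mat \<Rightarrow> real) \<Rightarrow> real \<Rightarrow> real mat \<Rightarrow> real mat list \<Rightarrow> bool" where
  "rejects f \<alpha> X gs \<longleftrightarrow>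
     ereal (f X) > order_stat (f X # map (\<lambda>g. f (g * X)) gs)
                     (nat \<lceil>(1 - \<alpha>) * (real (length gs) + 1)\<rceil>)"

(* The product measure makes the K iid uniform draws from G independent of the data. *)
definition rejection_prob ::
  "'w measure \<Rightarrow> real mat set \<Rightarrow> (real mat \<Rightarrow> real) \<Rightarrow> real \<Rightarrow> nat \<Rightarrow> ('w \<Rightarrow> real mat) \<Rightarrow> real" where
  "rejection_prob M G f \<alpha> K X =
     (let Q = M \<Otimes>\<^sub>M measure_pmf (replicate_pmf K (pmf_of_set G))
      in measure Q {z \<in> space Q. rejects f \<alpha> (X (fst z)) (snd z)})"

(* \<beta> m s is the rejection probability of the m-th test under the signal s. *)
definition consistent_against ::
  "(nat \<Rightarrow> real vec \<Rightarrow> real) \<Rightarrow> (nat \<Rightarrow> real vec set) \<Rightarrow> bool" where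
  "consistent_against \<beta> \<Theta> \<longleftrightarrow>
     (\<forall>s. (\<forall>m. s m \<in> \<Theta> m) \<longrightarrow> (\<lambda>m. \<beta> m (s m)) \<longlonglongrightarrow> 1)"

end

theory Submission
  imports Defs
begin

text \<open>
  Since \<open>\<alpha> (K + 1) \<ge> 1\<close>, for \<open>\<alpha> < 1\<close> the test rejects as soon as the statistic of \<open>X\<close> strictly
  exceeds that of every \<open>G\<^sub>k X\<close>.  The former is at least \<open>\<parallel>s\<parallel> - t\<close> once the mean noise is at most \<open>t\<close>;
  the latter is at most \<open>\<bar>g\<bar> \<parallel>s\<parallel> + t\<close>, where \<open>g\<close> is the mean of the signs of \<open>G\<^sub>k\<close>, once the mean of
  the sign-flipped noise is at most \<open>t\<close>.  By symmetry and independence the flipped noise has the law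
  of the noise, and \<open>g\<close> tends to 0 in probability by Chebyshev's inequality, as its second moment is
  \<open>1/n\<close>.  So \<open>\<parallel>s\<parallel> \<ge> 2 c t\<close> with a fixed \<open>c > 1\<close> suffices.
\<close>

section \<open>Order statistics\<close>

text \<open>By sortedness the positions holding entries below \<open>x\<close> form an initial
  segment, so its size decides whether it contains \<open>j\<close>.\<close>

lemma sorted_nth_less_iff_card:
  fixes xs :: "'a :: linorder list"
  assumes "sorted xs" "j < length xs"
  shows "xs ! j < x \<longleftrightarrow> j < card {i. i < length xs \<and> xs ! i < x}"
proof
  assume "xs ! j < x"
  then have "{..j} \<subseteq> {i. i < length xs \<and> xs ! i < x}"
    using assms by (auto dest: sorted_nth_mono intro: le_less_trans)
  then have "card {..j} \<le> card {i. i < length xs \<and> xs ! i < x}"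
    by (intro card_mono) auto
  then show "j < card {i. i < length xs \<and> xs ! i < x}" by simp
next
  assume less: "j < card {i. i < length xs \<and> xs ! i < x}"
  show "xs ! j < x"
  proof (rule ccontr)
    assume "\<not> xs ! j < x"
    then have "{i. i < length xs \<and> xs ! i < x} \<subseteq> {..<j}"
      using assms by (auto simp: not_less) (meson leD leI le_less_trans sorted_nth_mono)
    then have "card {i. i < length xs \<and> xs ! i < x} \<le> card {..<j}"
      by (intro card_mono) auto
    with less show False by simp
  qed
qed

lemma sort_nth_less_iff_filter:
  fixes xs :: "'a :: linorder list"
  assumes "j < length xs"
  shows "sort xs ! j < x \<longleftrightarrow> j < length (filter (\<lambda>y. y < x) xs)"
proof -
  have "length (filter (\<lambda>y. y < x) (sort xs)) = length (filter (\<lambda>y. y < x) xs)"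
    by (metis mset_filter mset_sort size_mset)
  then show ?thesis
    using sorted_nth_less_iff_card[of "sort xs" j x] assms by (simp add: length_filter_conv_card)
qed

text \<open>Counting replaces sorting, which serves both the rejection criterion and measurability.
  The observed value is not strictly below itself, so only the draws are counted, and ties count
  against rejection.\<close>

lemma rejects_iff_card:
  assumes "0 < \<alpha>"
  shows "rejects f \<alpha> X gs \<longleftrightarrow>
    nat \<lceil>(1 - \<alpha>) * (real (length gs) + 1)\<rceil> \<le> card {i. i < length gs \<and> f (gs ! i * X) < f X}"
proof -
  define k where "k = nat \<lceil>(1 - \<alpha>) * (real (length gs) + 1)\<rceil>"
  define xs where "xs = f X # map (\<lambda>g. f (g * X)) gs"
  \<comment> \<open>Positivity of \<alpha> keeps the rank \<open>k\<close> within the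
    \<open>length gs + 1\<close> values, so position \<open>k - 1\<close> is a genuine list
    index.\<close>
  have "0 \<le> \<alpha> * (real (length gs) + 1)"
    using assms by simp
  then have k: "k \<le> length xs"
    unfolding k_def xs_def by (simp add: nat_le_iff ceiling_le_iff algebra_simps)
  have "length (filter (\<lambda>y. y < f X) xs) = length (filter (\<lambda>g. f (g * X) < f X) gs)"
    by (simp add: xs_def filter_map comp_def)
  also have "\<dots> = card {i. i < length gs \<and> f (gs ! i * X) < f X}"
    by (simp add: length_filter_conv_card)
  finally have count: "length (filter (\<lambda>y. y < f X) xs) = card {i. i < length gs \<and> f (gs ! i * X) < f X}" .
  have "rejects f \<alpha> X gs \<longleftrightarrow> ereal (f X) > order_stat xs k"
    by (simp add: rejects_def k_def xs_def)
  also have "\<dots> \<longleftrightarrow> k \<le> length (filter (\<lambda>y. y < f X) xs)"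
  proof (cases k)
    case 0
    then show ?thesis by (simp add: order_stat_def)
  next
    case (Suc j)
    then show ?thesis
      using sort_nth_less_iff_filter[of j xs "f X"] k by (simp add: order_stat_def Suc_le_eq)
  qed
  finally show ?thesis by (simp add: count k_def)
qed

text \<open>At level 1 the rank is 0, where the order statistic is minus infinity.\<close>

lemma rejects_level_one: "rejects f 1 X gs"
  by (simp add: rejects_def order_stat_def)

text \<open>The bound on \<open>\<alpha> * (real (length gs) + 1)\<close> pushes the rank down to at
  most the number of draws, so beating every draw is enough.\<close>

lemma rejectsI:
  assumes "0 < \<alpha>" "\<alpha> * (real (length gs) + 1) \<ge> 1"
    and "\<And>g. g \<in> set gs \<Longrightarrow> f (g * X) < f X"
  shows "rejects f \<alpha> X gs"
proof -
  have "{i. i < length gs \<and> f (gs ! i * X) < f X} = {..<length gs}"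
    using assms(3) by auto
  moreover have "(1 - \<alpha>) * (real (length gs) + 1) \<le> real (length gs)"
    using assms(2) by (simp add: algebra_simps)
  then have "nat \<lceil>(1 - \<alpha>) * (real (length gs) + 1)\<rceil> \<le> length gs"
    by (simp add: nat_le_iff ceiling_le_iff)
  ultimately show ?thesis
    by (simp add: rejects_iff_card[OF assms(1)])
qed

section \<open>The sup norm and the mean statistic\<close>

lemma abs_index_le_sup_norm: "j < dim_vec v \<Longrightarrow> \<bar>v $ j\<bar> \<le> sup_norm v"
  unfolding sup_norm_def by (intro Max_ge) auto

lemma sup_norm_le:
  assumes "0 < dim_vec v" "\<And>j. j < dim_vec v \<Longrightarrow> \<bar>v $ j\<bar> \<le> a"
  shows "sup_norm v \<le> a"
  unfolding sup_norm_def using assms by (subst Max_le_iff) auto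

lemma sup_norm_nonneg: "0 < dim_vec v \<Longrightarrow> 0 \<le> sup_norm v"
  using abs_index_le_sup_norm[of 0 v] by linarith

lemma sup_norm_add_le:
  assumes "dim_vec u = dim_vec v" "0 < dim_vec v"
  shows "sup_norm (u + v) \<le> sup_norm u + sup_norm v"
proof (rule sup_norm_le)
  fix j assume "j < dim_vec (u + v)"
  then have "\<bar>u $ j\<bar> \<le> sup_norm u" "\<bar>v $ j\<bar> \<le> sup_norm v"
    using assms by (auto intro: abs_index_le_sup_norm)
  then show "\<bar>(u + v) $ j\<bar> \<le> sup_norm u + sup_norm v"
    using \<open>j < dim_vec (u + v)\<close> by simp
qed (use assms in simp)

lemma sup_norm_smult:
  assumes "0 < dim_vec v"
  shows "sup_norm (c \<cdot>\<^sub>v v) = \<bar>c\<bar> * sup_norm v"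
proof -
  have "sup_norm (c \<cdot>\<^sub>v v) = Max ((\<lambda>x. \<bar>c\<bar> * x) ` (\<lambda>j. \<bar>v $ j\<bar>) ` {..<dim_vec v})"
    unfolding sup_norm_def image_image by (intro arg_cong[where f=Max] image_cong) (auto simp: abs_mult)
  also have "\<dots> = \<bar>c\<bar> * Max ((\<lambda>j. \<bar>v $ j\<bar>) ` {..<dim_vec v})"
    using assms by (intro mono_Max_commute[symmetric]) (auto intro!: monoI mult_left_mono)
  finally show ?thesis by (simp add: sup_norm_def)
qed

text \<open>Here \<open>g\<close> has arbitrary dimensions, as measurability requires. The entry is
  written \<open>row g i $ l\<close> because the scalar product behind the matrix product sums over
  the \<open>n\<close> indices of its second factor and reads exactly this value, even when
  \<open>l\<close> is beyond the columns of \<open>g\<close>.\<close>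

lemma mean_stat_mult_data_matrix:
  assumes "s \<in> carrier_vec p" "\<And>i. i < n \<Longrightarrow> N i \<in> carrier_vec p"
  shows "mean_stat (g * data_matrix n p s N) =
    sup_norm (vec p (\<lambda>j. \<Sum>l<n. (\<Sum>i<dim_row g. row g i $ l) * (s $ j + N l $ j))) / real (dim_row g)"
proof -
  let ?X = "data_matrix n p s N"
  have dims: "dim_row ?X = n" "dim_col ?X = p"
    by (auto simp: data_matrix_def)
  have entry: "?X $$ (l, j) = s $ j + N l $ j" if "l < n" "j < p" for l j
  proof -
    have "dim_vec (N l) = p"
      using assms(2) \<open>l < n\<close> by auto
    then show ?thesis
      using that by (simp add: data_matrix_def mat_of_rows_index)
  qed
  have "(g * ?X)\<^sup>T *\<^sub>v vec (dim_row (g * ?X)) (\<lambda>_. 1) =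
      vec p (\<lambda>j. \<Sum>l<n. (\<Sum>i<dim_row g. row g i $ l) * (s $ j + N l $ j))"
  proof (intro eq_vecI)
    fix j assume "j < dim_vec (vec p (\<lambda>j. \<Sum>l<n. (\<Sum>i<dim_row g. row g i $ l) * (s $ j + N l $ j)))"
    then have j: "j < p" by simp
    have "((g * ?X)\<^sup>T *\<^sub>v vec (dim_row (g * ?X)) (\<lambda>_. 1)) $ j = (\<Sum>i<dim_row g. (g * ?X) $$ (i, j))"
      using j dims by (simp add: scalar_prod_def atLeast0LessThan)
    also have "\<dots> = (\<Sum>i<dim_row g. \<Sum>l<n. row g i $ l * (s $ j + N l $ j))"
      using j dims by (intro sum.cong) (auto simp: scalar_prod_def atLeast0LessThan entry)
    also have "\<dots> = (\<Sum>l<n. (\<Sum>i<dim_row g. row g i $ l) * (s $ j + N l $ j))"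
      by (subst sum.swap) (simp add: sum_distrib_right)
    finally show "((g * ?X)\<^sup>T *\<^sub>v vec (dim_row (g * ?X)) (\<lambda>_. 1)) $ j =
        vec p (\<lambda>j. \<Sum>l<n. (\<Sum>i<dim_row g. row g i $ l) * (s $ j + N l $ j)) $ j"
      using j by simp
  qed (simp add: dims)
  then show ?thesis by (simp add: mean_stat_def)
qed

section \<open>The sign group\<close>

text \<open>The factor left on the signal after sign flipping and averaging, since the signal is the
  same in every row.\<close>

definition mean_sign :: "nat \<Rightarrow> real mat \<Rightarrow> real" where
  "mean_sign n D = (\<Sum>i<n. D $$ (i,i)) / real n"

lemma one_mat_in_sign_group: "1\<^sub>m n \<in> sign_group n"
  by (auto simp: sign_group_def diagonal_mat_def)

lemma mean_sign_one: "n \<ge> 1 \<Longrightarrow> mean_sign n (1\<^sub>m n) = 1"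
  by (simp add: mean_sign_def)

text \<open>A diagonal matrix has its diagonal entries as column sums, so the statistic separates
  into a shrunken signal and the mean of the flipped noise.\<close>

lemma mean_stat_sign_mult:
  assumes D: "D \<in> sign_group n" and n: "n \<ge> 1"
    and s: "s \<in> carrier_vec p" and N: "\<And>i. i < n \<Longrightarrow> N i \<in> carrier_vec p" and p: "p \<ge> 1"
  shows "mean_stat (D * data_matrix n p s N) =
    sup_norm (mean_sign n D \<cdot>\<^sub>v s + mean_vec n p (\<lambda>i. D $$ (i,i) \<cdot>\<^sub>v N i))"
proof -
  have dims: "dim_row D = n" "dim_col D = n"
    using D by (auto simp: sign_group_def)
  have col_sum: "(\<Sum>i<dim_row D. row D i $ l) = D $$ (l,l)" if "l < n" for l
  proof -
    have "(\<Sum>i<dim_row D. row D i $ l) = (\<Sum>i<n. if i = l then D $$ (l,l) else 0)"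
      using D that dims by (intro sum.cong) (auto simp: sign_group_def diagonal_mat_def)
    then show ?thesis using that by simp
  qed
  have "vec p (\<lambda>j. \<Sum>l<n. (\<Sum>i<dim_row D. row D i $ l) * (s $ j + N l $ j)) =
      real n \<cdot>\<^sub>v (mean_sign n D \<cdot>\<^sub>v s + mean_vec n p (\<lambda>i. D $$ (i,i) \<cdot>\<^sub>v N i))"
  proof (intro eq_vecI)
    fix j assume "j < dim_vec (real n \<cdot>\<^sub>v (mean_sign n D \<cdot>\<^sub>v s + mean_vec n p (\<lambda>i. D $$ (i,i) \<cdot>\<^sub>v N i)))"
    then have j: "j < p" by (simp add: mean_vec_def)
    have "dim_vec (N l) = p" if "l < n" for l
      using N[OF that] by auto
    then have "(\<Sum>l<n. (\<Sum>i<dim_row D. row D i $ l) * (s $ j + N l $ j)) =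
        (\<Sum>l<n. D $$ (l,l) * s $ j + (D $$ (l,l) \<cdot>\<^sub>v N l) $ j)"
      using j by (intro sum.cong refl) (simp add: col_sum distrib_left)
    then show "vec p (\<lambda>j. \<Sum>l<n. (\<Sum>i<dim_row D. row D i $ l) * (s $ j + N l $ j)) $ j =
      (real n \<cdot>\<^sub>v (mean_sign n D \<cdot>\<^sub>v s + mean_vec n p (\<lambda>i. D $$ (i,i) \<cdot>\<^sub>v N i))) $ j"
      using j s n by (simp add: mean_vec_def mean_sign_def sum.distrib sum_distrib_right distrib_left)
  qed (simp add: mean_vec_def)
  then show ?thesis
    using n p by (simp add: mean_stat_mult_data_matrix[OF s N] dims sup_norm_smult mean_vec_def)
qed

lemma sum_sign_group_cross:
  assumes "i < n" "j < n" "i \<noteq> j"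
  shows "(\<Sum>D\<in>sign_group n. D $$ (i,i) * D $$ (j,j)) = 0"
proof -
  define flip :: "real mat \<Rightarrow> real mat" where
    "flip D = mat n n (\<lambda>(a,b). if a = i \<and> b = i then - D $$ (a,b) else D $$ (a,b))" for D
  \<comment> \<open>flip is an involution of the group that negates every summand\<close>
  have mem: "flip D \<in> sign_group n" if "D \<in> sign_group n" for D
    using that by (auto simp: flip_def sign_group_def diagonal_mat_def)
  have inv: "flip (flip D) = D" if "D \<in> sign_group n" for D
    using that by (intro eq_matI) (auto simp: flip_def sign_group_def)
  have "(\<Sum>D\<in>sign_group n. D $$ (i,i) * D $$ (j,j)) = (\<Sum>D\<in>sign_group n. - (D $$ (i,i) * D $$ (j,j)))"
    by (rule sum.reindex_bij_witness[of _ flip flip])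
      (use assms mem inv in \<open>auto simp: flip_def\<close>)
  then show ?thesis by (simp add: sum_negf)
qed

text \<open>Expanding the square, the cross terms cancel over the group and each of the
  \<open>n\<close> squared signs is 1. Dividing by the group order gives the second moment
  \<open>1 / n\<close>.\<close>

lemma sum_sign_group_mean_sign_sq:
  assumes "n \<ge> 1"
  shows "(\<Sum>D\<in>sign_group n. (mean_sign n D)\<^sup>2) = real (card (sign_group n)) / real n"
proof -
  have "(\<Sum>D\<in>sign_group n. (\<Sum>i<n. D $$ (i,i))\<^sup>2) =
      (\<Sum>i<n. \<Sum>j<n. \<Sum>D\<in>sign_group n. D $$ (i,i) * D $$ (j,j))"
    unfolding power2_eq_square sum_product
    by (subst sum.swap, intro sum.cong refl, subst sum.swap) simp
  also have "\<dots> = (\<Sum>i<n. \<Sum>j<n. if j = i then real (card (sign_group n)) else 0)"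
  proof (intro sum.cong refl)
    fix i j assume ij: "i \<in> {..<n}" "j \<in> {..<n}"
    have "(\<Sum>D\<in>sign_group n. D $$ (i,i) * D $$ (i,i)) = (\<Sum>D\<in>sign_group n. 1)"
      using ij by (intro sum.cong) (auto simp: sign_group_def)
    then show "(\<Sum>D\<in>sign_group n. D $$ (i,i) * D $$ (j,j)) =
        (if j = i then real (card (sign_group n)) else 0)"
      using ij sum_sign_group_cross[of i n j] by auto
  qed
  also have "\<dots> = real n * real (card (sign_group n))"
    by simp
  finally have "(\<Sum>D\<in>sign_group n. (\<Sum>i<n. D $$ (i,i))\<^sup>2) = real n * real (card (sign_group n))" .
  then show ?thesis
    using assms by (simp add: mean_sign_def power_divide flip: sum_divide_distrib)
      (simp add: power2_eq_square)
qed

text \<open>Chebyshev's inequality, carried out by counting in the finite group.\<close>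

lemma prob_mean_sign_less:
  assumes "n \<ge> 1" "\<delta> > 0"
  shows "measure (pmf_of_set (sign_group n)) {D. \<bar>mean_sign n D\<bar> < \<delta>} \<ge> 1 - 1 / (real n * \<delta>\<^sup>2)"
proof -
  let ?G = "sign_group n" and ?U = "pmf_of_set (sign_group n)"
  let ?B = "{D. \<delta> \<le> \<bar>mean_sign n D\<bar>}"
  have G: "real (card ?G) > 0"
    using finite_sign_group sign_group_nonempty by (simp add: card_gt_0_iff)
  have "real (card (?G \<inter> ?B)) * \<delta>\<^sup>2 = (\<Sum>D\<in>?G \<inter> ?B. \<delta>\<^sup>2)"
    by simp
  also have "\<dots> \<le> (\<Sum>D\<in>?G \<inter> ?B. (mean_sign n D)\<^sup>2)"
    using assms by (intro sum_mono) (auto simp: abs_le_square_iff[symmetric])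
  also have "\<dots> \<le> (\<Sum>D\<in>?G. (mean_sign n D)\<^sup>2)"
    by (intro sum_mono2 finite_sign_group) auto
  also have "\<dots> = real (card ?G) / real n"
    using assms by (intro sum_sign_group_mean_sign_sq)
  finally have "real (card (?G \<inter> ?B)) / real (card ?G) \<le> 1 / (real n * \<delta>\<^sup>2)"
    using G assms by (simp add: field_simps)
  then have "measure ?U ?B \<le> 1 / (real n * \<delta>\<^sup>2)"
    by (simp add: measure_pmf_of_set finite_sign_group sign_group_nonempty)
  moreover have "measure ?U {D. \<bar>mean_sign n D\<bar> < \<delta>} = 1 - measure ?U ?B"
    by (subst measure_pmf.prob_compl[symmetric]) (auto intro!: arg_cong[where f="measure ?U"])
  ultimately show ?thesis by simp
qed

text \<open>The draws are independent: splitting off the first one turns the event into a product of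
  indicators.\<close>

lemma emeasure_replicate_pmf_all:
  "emeasure (replicate_pmf K q) {xs. set xs \<subseteq> B} = emeasure q B ^ K"
proof (induction K)
  case (Suc K)
  have "emeasure (replicate_pmf (Suc K) q) {xs. set xs \<subseteq> B} =
      (\<integral>\<^sup>+x. \<integral>\<^sup>+xs. indicator B x * indicator {xs. set xs \<subseteq> B} xs \<partial>replicate_pmf K q \<partial>q)"
    by (auto simp: emeasure_bind_pmf indicator_def intro!: nn_integral_cong)
  also have "\<dots> = (\<integral>\<^sup>+x. indicator B x * emeasure (replicate_pmf K q) {xs. set xs \<subseteq> B} \<partial>q)"
    by (simp add: nn_integral_cmult)
  also have "\<dots> = emeasure q B ^ Suc K"
    by (simp add: nn_integral_multc Suc.IH)
  finally show ?case .
qed simp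

section \<open>Measurability\<close>

lemma space_borel_vec [simp]: "space (borel_vec p) = carrier_vec p"
  by (simp add: borel_vec_def)

lemma measurable_vec_index [measurable]:
  assumes "j < p"
  shows "(\<lambda>v. v $ j) \<in> borel_measurable (borel_vec p)"
proof -
  have "(\<lambda>v. \<lambda>j\<in>{..<p}. v $ j) \<in> borel_vec p \<rightarrow>\<^sub>M PiM {..<p} (\<lambda>_. borel :: real measure)"
    unfolding borel_vec_def by (intro measurable_vimage_algebra1) (auto simp: space_PiM)
  from measurable_compose[OF this measurable_component_singleton[of j]]
  show ?thesis using assms by simp
qed

text \<open>This is the universal property of the sigma-algebra induced by the coordinate
  map.\<close>

lemma measurable_borel_vecI:
  assumes "f \<in> space M \<rightarrow> carrier_vec p" "\<And>j. j < p \<Longrightarrow> (\<lambda>x. f x $ j) \<in> borel_measurable M"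
  shows "f \<in> M \<rightarrow>\<^sub>M borel_vec p"
  unfolding borel_vec_def
  using assms by (intro measurable_vimage_algebra2 measurable_restrict) auto

lemma borel_measurable_sup_norm_vec:
  assumes "\<And>j. j < p \<Longrightarrow> (\<lambda>x. h x j) \<in> borel_measurable M"
  shows "(\<lambda>x. sup_norm (vec p (h x))) \<in> borel_measurable M"
proof -
  have "sup_norm (vec p (h x)) = Max ((\<lambda>j. \<bar>h x j\<bar>) ` {..<p})" for x
    unfolding sup_norm_def by (intro arg_cong[where f=Max] image_cong) auto
  then show ?thesis
    using assms by (simp add: borel_measurable_Max)
qed

lemma borel_measurable_mean_vec:
  assumes "\<And>i. i < n \<Longrightarrow> N i \<in> M \<rightarrow>\<^sub>M borel_vec p"
  shows "(\<lambda>\<omega>. sup_norm (mean_vec n p (\<lambda>i. N i \<omega>))) \<in> borel_measurable M"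
  unfolding mean_vec_def
proof (intro borel_measurable_sup_norm_vec borel_measurable_divide borel_measurable_sum)
  fix j i assume "j < p" "i \<in> {..<n}"
  then show "(\<lambda>\<omega>. N i \<omega> $ j) \<in> borel_measurable M"
    using measurable_compose[OF assms measurable_vec_index] by blast
qed simp

text \<open>
  Lists outside the support of \<open>P\<close>, with matrices of arbitrary dimensions, matter too: the rejection
  event over this uncountable discrete space must still be product measurable, as
  \<open>measure\<close> is 0 on a non-measurable set.  The column sums of \<open>g\<close> are functions of \<open>g\<close> alone, hence
  measurable for the discrete sigma-algebra, and the statistic of \<open>g * X\<close> depends on \<open>g\<close> only
  through them and its number of rows.
\<close>

lemma sets_rejects:
  fixes P :: "real mat list pmf"
  assumes \<alpha>: "0 < \<alpha>" and s: "s \<in> carrier_vec p"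
    and N: "\<And>i. i < n \<Longrightarrow> N i \<in> M \<rightarrow>\<^sub>M borel_vec p"
  shows "{z \<in> space (M \<Otimes>\<^sub>M measure_pmf P).
      rejects mean_stat \<alpha> (data_matrix n p s (\<lambda>i. N i (fst z))) (snd z)} \<in> sets (M \<Otimes>\<^sub>M measure_pmf P)"
proof -
  let ?Q = "M \<Otimes>\<^sub>M measure_pmf P"
  define X where "X \<omega> = data_matrix n p s (\<lambda>i. N i \<omega>)" for \<omega>
  have snd_meas: "(\<lambda>z. h (snd z)) \<in> borel_measurable ?Q" for h :: "_ \<Rightarrow> real"
    by (rule measurable_compose[OF measurable_snd]) simp
  have N_meas: "(\<lambda>z. N l (fst z) $ j) \<in> borel_measurable ?Q" if "l < n" "j < p" for l j
    using measurable_compose[OF measurable_fst measurable_compose[OF N measurable_vec_index]] that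
    by blast
  have col_sum_meas: "(\<lambda>z. \<Sum>i<dim_row (h (snd z)). row (h (snd z)) i $ l) \<in> borel_measurable ?Q"
    for h :: "_ \<Rightarrow> real mat" and l
    by (rule snd_meas)
  have dim_meas: "(\<lambda>z. real (dim_row (h (snd z)))) \<in> borel_measurable ?Q" for h :: "_ \<Rightarrow> real mat"
    by (rule snd_meas)
  have stat: "(\<lambda>z. mean_stat (h (snd z) * X (fst z))) \<in> borel_measurable ?Q" for h
  proof (subst measurable_cong)
    show "mean_stat (h (snd z) * X (fst z)) = sup_norm (vec p (\<lambda>j. \<Sum>l<n.
        (\<Sum>i<dim_row (h (snd z)). row (h (snd z)) i $ l) * (s $ j + N l (fst z) $ j))) /
        real (dim_row (h (snd z)))" if "z \<in> space ?Q" for z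
      unfolding X_def
      using s that measurable_space[OF N]
      by (intro mean_stat_mult_data_matrix) (auto simp: space_pair_measure)
    show "(\<lambda>z. sup_norm (vec p (\<lambda>j. \<Sum>l<n.
        (\<Sum>i<dim_row (h (snd z)). row (h (snd z)) i $ l) * (s $ j + N l (fst z) $ j))) /
        real (dim_row (h (snd z)))) \<in> borel_measurable ?Q"
      by (intro borel_measurable_divide borel_measurable_sup_norm_vec borel_measurable_sum
          borel_measurable_times borel_measurable_add borel_measurable_const
          col_sum_meas dim_meas N_meas) auto
  qed
  \<comment> \<open>Multiplying by the identity makes the statistic of the unflipped data an
    instance of \<open>stat\<close>.\<close>
  have one: "1\<^sub>m n * X \<omega> = X \<omega>" for \<omega>
    by (intro left_mult_one_mat[where nc=p]) (auto simp: X_def data_matrix_def)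
  have X_meas: "(\<lambda>z. mean_stat (X (fst z))) \<in> borel_measurable ?Q"
    using stat[of "\<lambda>_. 1\<^sub>m n"] by (simp add: one)
  have less: "{z \<in> space ?Q. i < length (snd z) \<and> mean_stat (snd z ! i * X (fst z)) < mean_stat (X (fst z))}
      \<in> sets ?Q" for i
  proof (rule sets.sets_Collect_conj)
    show "{z \<in> space ?Q. i < length (snd z)} \<in> sets ?Q"
      using borel_measurable_less[OF borel_measurable_const snd_meas[of "\<lambda>gs. real (length gs)"], of "real i"]
      by simp
    show "{z \<in> space ?Q. mean_stat (snd z ! i * X (fst z)) < mean_stat (X (fst z))} \<in> sets ?Q"
      by (intro borel_measurable_less stat X_meas)
  qed
  \<comment> \<open>The index ranges over all naturals because the lists have no common length; the
    events \<open>less\<close> for each index make the count measurable.\<close>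
  have "(\<lambda>z. card {i. i < length (snd z) \<and> mean_stat (snd z ! i * X (fst z)) < mean_stat (X (fst z))})
      \<in> ?Q \<rightarrow>\<^sub>M count_space UNIV"
    by (rule measurable_card) (simp add: less)
  then have "(\<lambda>z. real (card {i. i < length (snd z) \<and>
      mean_stat (snd z ! i * X (fst z)) < mean_stat (X (fst z))})) \<in> borel_measurable ?Q"
    by (rule measurable_compose) simp
  from borel_measurable_le[OF snd_meas[of "\<lambda>gs. real (nat \<lceil>(1 - \<alpha>) * (real (length gs) + 1)\<rceil>)"] this]
  show ?thesis
    unfolding rejects_iff_card[OF \<alpha>] X_def of_nat_le_iff .
qed

section \<open>Sign invariance of the noise\<close>

text \<open>By independence both joint laws are products of marginals. Fixed signs preserve
  independence, and symmetry leaves each marginal unchanged.\<close>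

lemma (in prob_space) distr_sign_smult:
  assumes indep: "indep_vars (\<lambda>_. borel_vec p) N I" and I: "I \<noteq> {}"
    and symm: "\<And>i. i \<in> I \<Longrightarrow> distr M (borel_vec p) (N i) = distr M (borel_vec p) (\<lambda>\<omega>. - N i \<omega>)"
    and d: "\<And>i. i \<in> I \<Longrightarrow> d i \<in> {1, -1 :: real}"
  shows "distr M (PiM I (\<lambda>_. borel_vec p)) (\<lambda>\<omega>. \<lambda>i\<in>I. d i \<cdot>\<^sub>v N i \<omega>) =
    distr M (PiM I (\<lambda>_. borel_vec p)) (\<lambda>\<omega>. \<lambda>i\<in>I. N i \<omega>)"
proof -
  have rv: "N i \<in> M \<rightarrow>\<^sub>M borel_vec p" if "i \<in> I" for i
    using indep that by (auto simp: indep_vars_def)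
  have smult: "(\<lambda>v. c \<cdot>\<^sub>v v) \<in> borel_vec p \<rightarrow>\<^sub>M borel_vec p" for c :: real
  proof (rule measurable_borel_vecI)
    fix j assume j: "j < p"
    have "(\<lambda>v. c * v $ j) \<in> borel_measurable (borel_vec p)"
      using j by measurable
    then show "(\<lambda>v. (c \<cdot>\<^sub>v v) $ j) \<in> borel_measurable (borel_vec p)"
      using j by (subst measurable_cong[where g="\<lambda>v. c * v $ j"]) auto
  qed auto
  have indep': "indep_vars (\<lambda>_. borel_vec p) (\<lambda>i \<omega>. d i \<cdot>\<^sub>v N i \<omega>) I"
    by (rule indep_vars_compose2[OF indep]) (rule smult)
  have marginal: "distr M (borel_vec p) (\<lambda>\<omega>. d i \<cdot>\<^sub>v N i \<omega>) = distr M (borel_vec p) (N i)"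
    if i: "i \<in> I" for i
  proof (cases "d i = 1")
    case True
    then show ?thesis by (simp add: one_smult_vec)
  next
    case False
    then have "(\<lambda>\<omega>. d i \<cdot>\<^sub>v N i \<omega>) = (\<lambda>\<omega>. - N i \<omega>)"
      using d[OF i] by (auto intro!: eq_vecI)
    then show ?thesis using symm[OF i] by simp
  qed
  have "distr M (PiM I (\<lambda>_. borel_vec p)) (\<lambda>\<omega>. \<lambda>i\<in>I. d i \<cdot>\<^sub>v N i \<omega>) =
      PiM I (\<lambda>i. distr M (borel_vec p) (\<lambda>\<omega>. d i \<cdot>\<^sub>v N i \<omega>))"
    using indep_vars_iff_distr_eq_PiM'[OF I, of "\<lambda>i \<omega>. d i \<cdot>\<^sub>v N i \<omega>" "\<lambda>_. borel_vec p"]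
      indep' measurable_compose[OF rv smult] by simp
  also have "\<dots> = PiM I (\<lambda>i. distr M (borel_vec p) (N i))"
    by (intro PiM_cong marginal refl)
  also have "\<dots> = distr M (PiM I (\<lambda>_. borel_vec p)) (\<lambda>\<omega>. \<lambda>i\<in>I. N i \<omega>)"
    using indep_vars_iff_distr_eq_PiM'[OF I, of N "\<lambda>_. borel_vec p"] indep rv by simp
  finally show ?thesis .
qed

text \<open>The equality of joint laws is pulled back to the event on the mean. Membership in
  \<open>events\<close> is recorded as well for the later union bound over several sign
  matrices.\<close>

lemma (in prob_space) prob_mean_vec_sign_smult:
  assumes indep: "indep_vars (\<lambda>_. borel_vec p) N {..<n}" and n: "n \<ge> 1"
    and symm: "\<And>i. i < n \<Longrightarrow> distr M (borel_vec p) (N i) = distr M (borel_vec p) (\<lambda>\<omega>. - N i \<omega>)"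
    and D: "D \<in> sign_group n"
  shows "prob {\<omega> \<in> space M. sup_norm (mean_vec n p (\<lambda>i. D $$ (i,i) \<cdot>\<^sub>v N i \<omega>)) \<le> t} =
    prob {\<omega> \<in> space M. sup_norm (mean_vec n p (\<lambda>i. N i \<omega>)) \<le> t}"
    and "{\<omega> \<in> space M. sup_norm (mean_vec n p (\<lambda>i. D $$ (i,i) \<cdot>\<^sub>v N i \<omega>)) \<le> t} \<in> events"
proof -
  let ?P = "PiM {..<n} (\<lambda>_. borel_vec p)"
  let ?A = "{x \<in> space ?P. sup_norm (mean_vec n p x) \<le> t}"
  have rv: "N i \<in> M \<rightarrow>\<^sub>M borel_vec p" if "i < n" for i
    using indep that by (auto simp: indep_vars_def)
  have d: "D $$ (i,i) \<in> {1, -1}" if "i < n" for i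
    using D that by (auto simp: sign_group_def)
  have "(\<lambda>x. sup_norm (mean_vec n p (\<lambda>i. x i))) \<in> borel_measurable ?P"
    by (intro borel_measurable_mean_vec measurable_component_singleton) auto
  then have A: "?A \<in> sets ?P" by measurable
  \<comment> \<open>The mean reads only indices below \<open>n\<close>, so passing to restricted
    functions, the points of the product space, does not change it.\<close>
  have mean_restrict: "mean_vec n p (\<lambda>i\<in>{..<n}. Z i) = mean_vec n p Z" for Z
    by (simp add: mean_vec_def)
  have vimage: "(\<lambda>\<omega>. \<lambda>i\<in>{..<n}. Z i \<omega>) -` ?A \<inter> space M =
      {\<omega> \<in> space M. sup_norm (mean_vec n p (\<lambda>i. Z i \<omega>)) \<le> t}"
    if "(\<lambda>\<omega>. \<lambda>i\<in>{..<n}. Z i \<omega>) \<in> M \<rightarrow>\<^sub>M ?P" for Z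
    using measurable_space[OF that] by (auto simp: mean_restrict)
  have smult: "(\<lambda>\<omega>. D $$ (i,i) \<cdot>\<^sub>v N i \<omega>) \<in> M \<rightarrow>\<^sub>M borel_vec p" if i: "i < n" for i
  proof (rule measurable_borel_vecI)
    show "(\<lambda>\<omega>. D $$ (i,i) \<cdot>\<^sub>v N i \<omega>) \<in> space M \<rightarrow> carrier_vec p"
      using measurable_space[OF rv[OF i]] by auto
    fix j assume j: "j < p"
    have "(\<lambda>\<omega>. D $$ (i,i) * N i \<omega> $ j) \<in> borel_measurable M"
      using measurable_compose[OF rv[OF i] measurable_vec_index[OF j]] by measurable
    moreover have "dim_vec (N i \<omega>) = p" if "\<omega> \<in> space M" for \<omega>
      using measurable_space[OF rv[OF i] that] by auto
    ultimately show "(\<lambda>\<omega>. (D $$ (i,i) \<cdot>\<^sub>v N i \<omega>) $ j) \<in> borel_measurable M"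
      using j by (subst measurable_cong[where g="\<lambda>\<omega>. D $$ (i,i) * N i \<omega> $ j"]) auto
  qed
  have m1: "(\<lambda>\<omega>. \<lambda>i\<in>{..<n}. D $$ (i,i) \<cdot>\<^sub>v N i \<omega>) \<in> M \<rightarrow>\<^sub>M ?P"
    and m2: "(\<lambda>\<omega>. \<lambda>i\<in>{..<n}. N i \<omega>) \<in> M \<rightarrow>\<^sub>M ?P"
    using smult rv by (auto intro!: measurable_restrict)
  have "distr M ?P (\<lambda>\<omega>. \<lambda>i\<in>{..<n}. D $$ (i,i) \<cdot>\<^sub>v N i \<omega>) = distr M ?P (\<lambda>\<omega>. \<lambda>i\<in>{..<n}. N i \<omega>)"
    by (rule distr_sign_smult[OF indep _ symm d]) (use n in \<open>auto simp: lessThan_empty_iff\<close>)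
  then have "measure (distr M ?P (\<lambda>\<omega>. \<lambda>i\<in>{..<n}. D $$ (i,i) \<cdot>\<^sub>v N i \<omega>)) ?A =
      measure (distr M ?P (\<lambda>\<omega>. \<lambda>i\<in>{..<n}. N i \<omega>)) ?A" by simp
  then show "prob {\<omega> \<in> space M. sup_norm (mean_vec n p (\<lambda>i. D $$ (i,i) \<cdot>\<^sub>v N i \<omega>)) \<le> t} =
      prob {\<omega> \<in> space M. sup_norm (mean_vec n p (\<lambda>i. N i \<omega>)) \<le> t}"
    unfolding measure_distr[OF m1 A] measure_distr[OF m2 A] vimage[OF m1] vimage[OF m2] .
  show "{\<omega> \<in> space M. sup_norm (mean_vec n p (\<lambda>i. D $$ (i,i) \<cdot>\<^sub>v N i \<omega>)) \<le> t} \<in> events"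
    using measurable_sets[OF m1 A] unfolding vimage[OF m1] .
qed

section \<open>Consistency\<close>

text \<open>A deterministic comparison. The two triangle inequalities leave a gap of at least
  \<open>(1 - \<bar>mean_sign n D\<bar>) * sup_norm s - 2 * t\<close>; the threshold
  \<open>1 - 1 / c\<close> makes its first term exceed \<open>sup_norm s / c\<close>, which is at
  least \<open>2 * t\<close>.\<close>

lemma mean_stat_sign_mult_less:
  assumes D: "D \<in> sign_group n" and n: "n \<ge> 1" and p: "p \<ge> 1"
    and s: "s \<in> carrier_vec p" and N: "\<And>i. i < n \<Longrightarrow> N i \<in> carrier_vec p"
    and noise: "sup_norm (mean_vec n p N) \<le> t"
    and noise_D: "sup_norm (mean_vec n p (\<lambda>i. D $$ (i,i) \<cdot>\<^sub>v N i)) \<le> t"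
    and c: "1 < c" and sep: "0 < sup_norm s" "c * (2 * t) \<le> sup_norm s"
    and D_small: "\<bar>mean_sign n D\<bar> < 1 - 1 / c"
  shows "mean_stat (D * data_matrix n p s N) < mean_stat (data_matrix n p s N)"
proof -
  let ?X = "data_matrix n p s N"
  have dim: "dim_vec s = p" "dim_vec (mean_vec n p Z) = p" for Z
    using s by (auto simp: mean_vec_def)
  have "mean_stat ?X = mean_stat (1\<^sub>m n * ?X)"
    by (subst left_mult_one_mat[where nc=p]) (auto simp: data_matrix_def)
  also have "\<dots> = sup_norm (1 \<cdot>\<^sub>v s + mean_vec n p (\<lambda>i. 1\<^sub>m n $$ (i,i) \<cdot>\<^sub>v N i))"
    using mean_stat_sign_mult[OF one_mat_in_sign_group n s N p] n by (simp add: mean_sign_one)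
  also have "\<dots> = sup_norm (s + mean_vec n p N)"
    by (simp add: mean_vec_def one_smult_vec)
  finally have X: "mean_stat ?X = sup_norm (s + mean_vec n p N)" .
  \<comment> \<open>Reverse triangle inequality, obtained by subtracting the noise from the noisy
    signal.\<close>
  have "s = (s + mean_vec n p N) + (-1) \<cdot>\<^sub>v mean_vec n p N"
    using dim by (intro eq_vecI) auto
  then have "sup_norm s \<le> sup_norm (s + mean_vec n p N) + sup_norm ((-1) \<cdot>\<^sub>v mean_vec n p N)"
    using sup_norm_add_le[of "s + mean_vec n p N" "(-1) \<cdot>\<^sub>v mean_vec n p N"] dim p by auto
  then have lower: "sup_norm s - t \<le> mean_stat ?X"
    using noise dim p by (simp add: X sup_norm_smult)
  have "mean_stat (D * ?X) \<le>
      sup_norm (mean_sign n D \<cdot>\<^sub>v s) + sup_norm (mean_vec n p (\<lambda>i. D $$ (i,i) \<cdot>\<^sub>v N i))"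
    using dim p by (subst mean_stat_sign_mult[OF D n s N p]) (auto intro: sup_norm_add_le)
  then have upper: "mean_stat (D * ?X) \<le> \<bar>mean_sign n D\<bar> * sup_norm s + t"
    using noise_D dim p by (simp add: sup_norm_smult)
  have "\<bar>mean_sign n D\<bar> * sup_norm s < (1 - 1 / c) * sup_norm s"
    using D_small sep by (intro mult_strict_right_mono)
  moreover have "2 * t \<le> sup_norm s / c"
    using sep c by (simp add: field_simps)
  ultimately show ?thesis
    using lower upper by (simp add: algebra_simps)
qed

text \<open>Conditionally on draws with small mean signs, rejection follows once the original noise
  and its \<open>K\<close> flipped versions are all bounded by \<open>t\<close>. Each of these
  events has probability \<open>q\<close>, so a union bound gives the first factor; the power is the
  probability that all draws have small mean signs.\<close>

lemma rejection_prob_ge: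
  fixes N :: "nat \<Rightarrow> 'w \<Rightarrow> real vec"
  assumes M: "prob_space M"
    and \<alpha>: "0 < \<alpha>" "\<alpha> * (real K + 1) \<ge> 1"
    and n: "n \<ge> 1" and p: "p \<ge> 1" and s: "s \<in> carrier_vec p"
    and indep: "prob_space.indep_vars M (\<lambda>_. borel_vec p) N {..<n}"
    and symm: "\<And>i. i < n \<Longrightarrow> distr M (borel_vec p) (N i) = distr M (borel_vec p) (\<lambda>\<omega>. - N i \<omega>)"
    and c: "1 < c" and sep: "0 < sup_norm s" "c * (2 * t) \<le> sup_norm s"
    and bound: "0 \<le> 1 - (real K + 1) * (1 - q)"
    and q: "q = measure M {\<omega> \<in> space M. sup_norm (mean_vec n p (\<lambda>i. N i \<omega>)) \<le> t}"
  shows "rejection_prob M (sign_group n) mean_stat \<alpha> K (\<lambda>\<omega>. data_matrix n p s (\<lambda>i. N i \<omega>)) \<ge>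
    (1 - (real K + 1) * (1 - q)) *
      measure (pmf_of_set (sign_group n)) {D. \<bar>mean_sign n D\<bar> < 1 - 1 / c} ^ K"
proof -
  interpret prob_space M by fact
  let ?U = "pmf_of_set (sign_group n)"
  define P where "P = replicate_pmf K ?U"
  interpret P: prob_space "measure_pmf P" by (rule prob_space_measure_pmf)
  interpret PM: pair_prob_space M "measure_pmf P" ..
  let ?Q = "M \<Otimes>\<^sub>M measure_pmf P"
  define X where "X \<omega> = data_matrix n p s (\<lambda>i. N i \<omega>)" for \<omega>
  define A where "A = {z \<in> space ?Q. rejects mean_stat \<alpha> (X (fst z)) (snd z)}"
  define B where "B = {D. \<bar>mean_sign n D\<bar> < 1 - 1 / c}"
  define r where "r = 1 - (real K + 1) * (1 - q)"
  define E where "E D = {\<omega> \<in> space M. sup_norm (mean_vec n p (\<lambda>i. D $$ (i,i) \<cdot>\<^sub>v N i \<omega>)) \<le> t}"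
    for D :: "real mat"
  have rv: "N i \<in> M \<rightarrow>\<^sub>M borel_vec p" if "i < n" for i
    using indep that by (auto simp: indep_vars_def)
  have A: "A \<in> sets ?Q"
    unfolding A_def X_def using \<alpha>(1) s rv by (rule sets_rejects)
  have E: "E D \<in> events" "prob (E D) = q" if "D \<in> sign_group n" for D
    unfolding E_def q using prob_mean_vec_sign_smult[OF indep n symm that] by auto
  have E_one: "E (1\<^sub>m n) = {\<omega> \<in> space M. sup_norm (mean_vec n p (\<lambda>i. N i \<omega>)) \<le> t}"
    by (simp add: E_def mean_vec_def one_smult_vec)
  have slice: "ennreal r \<le> emeasure M ((\<lambda>\<omega>. (\<omega>, gs)) -` A)"
    if gs: "gs \<in> set_pmf P" "set gs \<subseteq> B" for gs
  proof -
    \<comment> \<open>The identity stands for the unflipped noise.\<close>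
    let ?H = "insert (1\<^sub>m n) (set gs)"
    let ?S = "(\<lambda>\<omega>. (\<omega>, gs)) -` A"
    have len: "length gs = K" and mem: "set gs \<subseteq> sign_group n"
      using gs(1) by (auto simp: P_def set_replicate_pmf finite_sign_group sign_group_nonempty)
    have H: "?H \<subseteq> sign_group n"
      using mem one_mat_in_sign_group by auto
    have S: "?S \<in> events"
      using sets_Pair2[OF A] .
    have "(\<Inter>D\<in>?H. E D) \<subseteq> ?S"
    proof
      fix \<omega> assume \<omega>: "\<omega> \<in> (\<Inter>D\<in>?H. E D)"
      then have "\<omega> \<in> E (1\<^sub>m n)" by blast
      then have space: "\<omega> \<in> space M" and noise: "sup_norm (mean_vec n p (\<lambda>i. N i \<omega>)) \<le> t"
        unfolding E_one by auto
      have "rejects mean_stat \<alpha> (X \<omega>) gs"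
      proof (rule rejectsI)
        fix g assume g: "g \<in> set gs"
        then have "\<omega> \<in> E g" using \<omega> by blast
        then show "mean_stat (g * X \<omega>) < mean_stat (X \<omega>)"
          unfolding X_def using g mem gs(2) n p s c sep noise measurable_space[OF rv space]
          by (intro mean_stat_sign_mult_less[where t=t and c=c]) (auto simp: E_def B_def)
      qed (use \<alpha> len in auto)
      then show "\<omega> \<in> ?S"
        using space by (simp add: A_def space_pair_measure)
    qed
    then have "space M - ?S \<subseteq> (\<Union>D\<in>?H. space M - E D)"
      by blast
    then have "prob (space M - ?S) \<le> prob (\<Union>D\<in>?H. space M - E D)"
      by (intro finite_measure_mono sets.finite_UN) (use E H in auto)
    also have "\<dots> \<le> (\<Sum>D\<in>?H. prob (space M - E D))"
      using E H by (intro finite_measure_subadditive_finite) auto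
    also have "\<dots> = (\<Sum>D\<in>?H. 1 - q)"
      using E H by (intro sum.cong refl) (auto simp: prob_compl)
    \<comment> \<open>Repeated draws, or a draw equal to the identity, can make \<open>?H\<close>
      smaller than \<open>K + 1\<close>; an upper bound on its size suffices as \<open>1 - q\<close>
      is nonnegative.\<close>
    also have "\<dots> \<le> (real K + 1) * (1 - q)"
    proof -
      have "card ?H \<le> Suc (card (set gs))" by (rule card_insert_le_m1) auto
      also have "\<dots> \<le> Suc K" using card_length[of gs] len by simp
      finally have "real (card ?H) \<le> real K + 1" by linarith
      then show ?thesis
        using prob_le_1 unfolding q by (simp only: sum_constant) (intro mult_right_mono, auto)
    qed
    finally have "r \<le> prob ?S"
      using S by (simp add: prob_compl r_def)
    then show ?thesis
      by (simp add: emeasure_eq_measure ennreal_leI)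
  qed
  \<comment> \<open>Nonnegativity of \<open>r\<close> prevents truncation at 0 in
    \<open>ennreal\<close> and lets the product split.\<close>
  have "ennreal (r * measure ?U B ^ K) = ennreal r * emeasure P {gs. set gs \<subseteq> B}"
    unfolding P_def emeasure_replicate_pmf_all measure_pmf.emeasure_eq_measure[of ?U]
    using bound by (simp add: ennreal_mult ennreal_power r_def)
  also have "\<dots> = (\<integral>\<^sup>+gs. ennreal r * indicator {gs. set gs \<subseteq> B} gs \<partial>P)"
    by (simp add: nn_integral_cmult)
  \<comment> \<open>The noise is integrated first, with the draws fixed. On the support,
    \<open>slice\<close> bounds the good lists from below; on all other lists the left integrand is
    0.\<close>
  also have "\<dots> \<le> (\<integral>\<^sup>+gs. emeasure M ((\<lambda>\<omega>. (\<omega>, gs)) -` A) \<partial>P)"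
    by (intro nn_integral_mono_AE AE_pmfI) (auto simp: indicator_def slice)
  also have "\<dots> = emeasure ?Q A"
    by (rule PM.emeasure_pair_measure_alt2[OF A, symmetric])
  also have "\<dots> = ennreal (measure ?Q A)"
    by (rule PM.P.emeasure_eq_measure)
  finally have "r * measure ?U B ^ K \<le> measure ?Q A"
    by (simp add: ennreal_le_iff)
  then show ?thesis
    by (simp add: rejection_prob_def Let_def A_def X_def B_def r_def P_def)
qed

text \<open>The case \<open>t = 0\<close> is covered too: \<open>a / 0\<close> in \<open>ereal\<close> is infinite for \<open>a > 0\<close>.\<close>

lemma separation_bound:
  fixes a t :: real
  assumes "ereal c < ereal a / ereal (2 * t)" "1 < c" "0 \<le> a"
  shows "0 < a \<and> c * (2 * t) \<le> a"
proof (cases "t = 0")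
  case True
  \<comment> \<open>The subcase \<open>a = 0\<close> is contradictory, because \<open>0 / 0\<close>
    is 0 in \<open>ereal\<close>.\<close>
  then show ?thesis
    using assms by (cases "a = 0") (auto simp: zero_ereal_def[symmetric])
next
  case False
  then have *: "c < a / (2 * t)" using assms(1) by simp
  \<comment> \<open>A positive ratio with nonnegative numerator also rules out negative
    \<open>t\<close>.\<close>
  with assms have "0 < a / (2 * t)" by linarith
  with assms(3) have "0 < t" "0 < a"
    by (auto simp: zero_less_divide_iff)
  with * show ?thesis by (simp add: field_simps)
qed

lemma rejection_prob_level_one:
  assumes "prob_space M"
  shows "rejection_prob M G f 1 K X = 1"
proof -
  interpret prob_space M by fact
  interpret P: prob_space "measure_pmf (replicate_pmf K (pmf_of_set G))"
    by (rule prob_space_measure_pmf)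
  interpret PM: pair_prob_space M "measure_pmf (replicate_pmf K (pmf_of_set G))" ..
  show ?thesis
    by (simp add: rejection_prob_def rejects_level_one PM.P.prob_space)
qed

text \<open>If \<alpha>(K + 1) < 1, the rank is K + 1 and the observed value can never exceed the
  maximum. If \<alpha> < 1 and \<open>n\<close> stays bounded along a subsequence, all draws are
  plus or minus the identity with probability bounded away from 0, and these ties prevent rejection.
  The conditions \<open>draws\<close> and \<open>sample_size\<close> exclude these cases.\<close>

theorem proposition3p1:
  fixes M :: "nat \<Rightarrow> 'w measure"
    and n p :: "nat \<Rightarrow> nat"
    and N :: "nat \<Rightarrow> nat \<Rightarrow> 'w \<Rightarrow> real vec"
    and \<Theta> :: "nat \<Rightarrow> real vec set"
    and \<alpha> :: real and K :: nat
  assumes level: "0 < \<alpha>" "\<alpha> \<le> 1"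
    and draws: "K \<ge> 1" "\<alpha> * (real K + 1) \<ge> 1"
    and dims: "\<And>m. n m \<ge> 1" "\<And>m. p m \<ge> 1"
    and sample_size: "\<alpha> < 1 \<Longrightarrow> filterlim n at_top sequentially"
    and prob_spaces: "\<And>m. prob_space (M m)"
    and noise_indep: "\<And>m. prob_space.indep_vars (M m) (\<lambda>_. borel_vec (p m)) (N m) {..<n m}"
    and noise_symmetric: "\<And>m i. i < n m \<Longrightarrow>
          distr (M m) (borel_vec (p m)) (N m i)
            = distr (M m) (borel_vec (p m)) (\<lambda>\<omega>. - N m i \<omega>)"
    and alternatives: "\<And>m. \<Theta> m \<subseteq> carrier_vec (p m)"
    and separation: "\<exists>t :: nat \<Rightarrow> real.
          (\<lambda>m. measure (M m) {\<omega> \<in> space (M m).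
                  sup_norm (mean_vec (n m) (p m) (\<lambda>i. N m i \<omega>)) \<le> t m}) \<longlonglongrightarrow> 1 \<and>
          (\<forall>s. (\<forall>m. s m \<in> \<Theta> m) \<longrightarrow>
             liminf (\<lambda>m. ereal (sup_norm (s m)) / ereal (2 * t m)) > 1)"
  shows "consistent_against
           (\<lambda>m s. rejection_prob (M m) (sign_group (n m)) mean_stat \<alpha> K
                    (\<lambda>\<omega>. data_matrix (n m) (p m) s (\<lambda>i. N m i \<omega>)))
           \<Theta>"
  unfolding consistent_against_def
proof (intro allI impI)
  fix s assume s: "\<forall>m. s m \<in> \<Theta> m"
  let ?\<beta> = "\<lambda>m. rejection_prob (M m) (sign_group (n m)) mean_stat \<alpha> K
    (\<lambda>\<omega>. data_matrix (n m) (p m) (s m) (\<lambda>i. N m i \<omega>))"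
  show "?\<beta> \<longlonglongrightarrow> 1"
  \<comment> \<open>At level 1 rejection is certain; growth of \<open>n\<close> is available only
    below level 1.\<close>
  proof (cases "\<alpha> = 1")
    case True
    then show ?thesis by (simp add: rejection_prob_level_one prob_spaces)
  next
    case False
    with level have n_top: "filterlim n at_top sequentially"
      by (intro sample_size) simp
    obtain t where
      noise: "(\<lambda>m. measure (M m) {\<omega> \<in> space (M m).
        sup_norm (mean_vec (n m) (p m) (\<lambda>i. N m i \<omega>)) \<le> t m}) \<longlonglongrightarrow> 1"
      and liminf: "liminf (\<lambda>m. ereal (sup_norm (s m)) / ereal (2 * t m)) > 1"
      using separation s by blast
    define q where "q m = measure (M m) {\<omega> \<in> space (M m).
        sup_norm (mean_vec (n m) (p m) (\<lambda>i. N m i \<omega>)) \<le> t m}" for m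
    \<comment> \<open>A real number strictly between 1 and the lower limit gives one separation
      margin valid for all large \<open>m\<close>.\<close>
    obtain c where c: "1 < c"
      "ereal c < liminf (\<lambda>m. ereal (sup_norm (s m)) / ereal (2 * t m))"
      using ereal_dense2[OF liminf] by (auto simp: one_ereal_def)
    define u where "u m = measure (pmf_of_set (sign_group (n m)))
      {D. \<bar>mean_sign (n m) D\<bar> < 1 - 1 / c}" for m
    define r where "r m = 1 - (real K + 1) * (1 - q m)" for m
    have carrier: "s m \<in> carrier_vec (p m)" for m
      using s alternatives by blast
    have \<delta>: "0 < 1 - 1 / c" using c by simp
    have q: "q \<longlonglongrightarrow> 1"
      using noise by (simp add: q_def[abs_def])
    \<comment> \<open>As \<open>K\<close> is fixed, the loss from the union bound over
      \<open>K + 1\<close> noise events vanishes.\<close>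
    have r: "r \<longlonglongrightarrow> 1"
      unfolding r_def by (auto intro!: tendsto_eq_intros q)
    have "u \<longlonglongrightarrow> 1"
    proof (rule tendsto_sandwich[OF _ _ _ tendsto_const])
      show "\<forall>\<^sub>F m in sequentially. 1 - 1 / (real (n m) * (1 - 1 / c)\<^sup>2) \<le> u m"
        unfolding u_def using dims \<delta> by (intro always_eventually allI prob_mean_sign_less)
      show "\<forall>\<^sub>F m in sequentially. u m \<le> 1"
        unfolding u_def by (simp add: measure_pmf.prob_le_1)
      have "filterlim (\<lambda>m. real (n m) * (1 - 1 / c)\<^sup>2) at_top sequentially"
        using \<delta> by (intro filterlim_at_top_mult_tendsto_pos[OF tendsto_const]
          filterlim_compose[OF filterlim_real_sequentially n_top]) auto
      then have "(\<lambda>m. 1 / (real (n m) * (1 - 1 / c)\<^sup>2)) \<longlonglongrightarrow> 0"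
        by (intro tendsto_divide_0[OF tendsto_const] filterlim_at_top_imp_at_infinity)
      from tendsto_diff[OF tendsto_const[of 1] this]
      show "(\<lambda>m. 1 - 1 / (real (n m) * (1 - 1 / c)\<^sup>2)) \<longlonglongrightarrow> 1"
        by simp
    qed
    then have lim: "(\<lambda>m. r m * u m ^ K) \<longlonglongrightarrow> 1"
      using r by (auto intro!: tendsto_eq_intros)
    show ?thesis
    proof (rule tendsto_sandwich[OF _ _ lim tendsto_const])
      \<comment> \<open>Eventual positivity supplies the nonnegativity required by
        \<open>rejection_prob_ge\<close>.\<close>
      have "\<forall>\<^sub>F m in sequentially. 0 < r m"
        using r by (rule order_tendstoD) simp
      moreover have "\<forall>\<^sub>F m in sequentially. ereal c < ereal (sup_norm (s m)) / ereal (2 * t m)"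
        using less_LiminfD[OF c(2)] .
      ultimately show "\<forall>\<^sub>F m in sequentially. r m * u m ^ K \<le> ?\<beta> m"
      proof eventually_elim
        case (elim m)
        have "0 < sup_norm (s m) \<and> c * (2 * t m) \<le> sup_norm (s m)"
          using elim(2) c(1) carrier[of m] dims(2)[of m]
          by (intro separation_bound sup_norm_nonneg) auto
        then show ?case
          unfolding r_def u_def using elim(1) level draws dims carrier c
          by (intro rejection_prob_ge[where t="t m"] prob_spaces noise_indep noise_symmetric)
            (auto simp: r_def q_def)
      qed
      show "\<forall>\<^sub>F m in sequentially. ?\<beta> m \<le> 1"
      proof (intro always_eventually allI)
        fix m
        interpret prob_space "M m" by (rule prob_spaces)
        interpret P: prob_space "measure_pmf (replicate_pmf K (pmf_of_set (sign_group (n m))))"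
          by (rule prob_space_measure_pmf)
        interpret PM: pair_prob_space "M m" "measure_pmf (replicate_pmf K (pmf_of_set (sign_group (n m))))" ..
        show "?\<beta> m \<le> 1"
          by (simp add: rejection_prob_def Let_def PM.P.prob_le_1)
      qed
    qed
  qed
qed

end
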